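(* Let $n\ge 2$. A nonempty subgraph $H\subset K_n$ (i.e. one with nonempty edge set) corresponds to an arrangement of largest minors in $Gr^+(2,n)$ if and only if every pair of edges in $H$ is crossing, or they share a common vertex.
   Context: $K_n$ is the complete graph on the vertices $1,\dots,n$, which are placed on a circle in clockwise order. Two-element subsets $\{i,j\}$ of $[n]=\{1,\dots,n\}$ are identified with edges of $K_n$, so a set of two-element subsets of $[n]$ is identified with a subgraph of $K_n$ (its edge set). For distinct $a,b,c,d$, the edges $\{a,b\}$ and $\{c,d\}$ are non-crossing if the straight-line chords $[a,b]$ and $[c,d]$ in the circle do not cross, and crossing otherwise. $Gr^+(2,n)$, the positive Grassmannian, is the space of real $2\times n$ matrices of rank $2$, modulo row operations, all of whose $2\times 2$ minors $\Delta_{ij}$ ($i<j$, in columns $i,j$; defined up to a common nonzero factor) have the same nonzero sign; we choose representatives with all $\Delta_{ij}>0$. A set $\mathcal{J}$ of two-element subsets of $[n]$ is an arrangement of largest minors in $Gr^+(2,n)$ if it is nonempty and there is a point of $Gr^+(2,n)$ at which all $\Delta_I$, $I\in\mathcal{J}$, are equal to each other and $\Delta_K<\Delta_I$ for all $I\in\mathcal{J}$ and all two-element subsets $K\notin\mathcal{J}$. *)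

theory Defs
  imports "HOL-Analysis.Line_Segment" "Jordan_Normal_Form.DL_Rank"
begin

definition two_subsets :: "nat \<Rightarrow> nat set set" where
  "two_subsets n = {e. e \<subseteq> {1..n} \<and> card e = 2}"

text \<open>A placement of the vertices \<open>1, \<dots>, n\<close> on some circle in clockwise order: clockwise means
  that the polar angle about the centre, which is \<open>- \<theta> k\<close> for vertex \<open>k\<close>, decreases, and the
  vertices go around less than once. The spacing is arbitrary.\<close>

definition clockwise_placement :: "nat \<Rightarrow> (nat \<Rightarrow> complex) \<Rightarrow> bool" where
  "clockwise_placement n P \<longleftrightarrow>
    (\<exists>(c::complex) (r::real) (\<theta>::nat \<Rightarrow> real).
       r > 0 \<and> strict_mono_on {1..n} \<theta> \<and> \<theta> n < \<theta> 1 + 2 * pi \<and>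
       (\<forall>k\<in>{1..n}. P k = c + of_real r * cis (- \<theta> k)))"

text \<open>Crossing is only meant for edges with four distinct endpoints; edges with a common vertex
  do not cross.\<close>

definition crossing :: "(nat \<Rightarrow> complex) \<Rightarrow> nat set \<Rightarrow> nat set \<Rightarrow> bool" where
  "crossing P e f \<longleftrightarrow>
    (\<exists>a b c d. distinct [a, b, c, d] \<and> e = {a, b} \<and> f = {c, d} \<and>
       closed_segment (P a) (P b) \<inter> closed_segment (P c) (P d) \<noteq> {})"

text \<open>Columns are numbered from 1, whereas the library numbers them from 0.\<close>

definition minor2 :: "real mat \<Rightarrow> nat set \<Rightarrow> real" where
  "minor2 A I = det (mat_of_cols 2 [col A (Min I - 1), col A (Max I - 1)])"

definition rank2_mats :: "nat \<Rightarrow> real mat set" where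
  "rank2_mats n = {A \<in> carrier_mat 2 n. vec_space.rank 2 A = 2}"

definition row_equiv :: "nat \<Rightarrow> (real mat \<times> real mat) set" where
  "row_equiv n = {(A, B). A \<in> rank2_mats n \<and> B \<in> rank2_mats n \<and>
     (\<exists>g \<in> carrier_mat 2 2. invertible_mat g \<and> B = g * A)}"

definition Gr_pos :: "nat \<Rightarrow> real mat set set" where
  "Gr_pos n = {X \<in> rank2_mats n // row_equiv n.
     \<forall>A\<in>X. (\<forall>I\<in>two_subsets n. minor2 A I > 0) \<or> (\<forall>I\<in>two_subsets n. minor2 A I < 0)}"

text \<open>The representatives of a point with all minors positive differ by a common positive factor
  of the minors, so the choice of \<open>A\<close> below does not matter.\<close>

definition arrangement_of_largest_minors :: "nat \<Rightarrow> nat set set \<Rightarrow> bool" where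
  "arrangement_of_largest_minors n J \<longleftrightarrow>
     J \<noteq> {} \<and> J \<subseteq> two_subsets n \<and>
     (\<exists>X\<in>Gr_pos n. \<exists>A\<in>X. (\<forall>I\<in>two_subsets n. minor2 A I > 0) \<and>
        (\<forall>I\<in>J. \<forall>I'\<in>J. minor2 A I = minor2 A I') \<and>
        (\<forall>I\<in>J. \<forall>K\<in>two_subsets n - J. minor2 A K < minor2 A I))"

end

theory Submission imports Defs begin

text \<open>
  Label the vertices in circular order. Four vertices \<open>i < j < k < l\<close> can be paired into two edges
  in three ways, of which only \<open>{i,k}, {j,l}\<close> is crossing; call two disjoint edges interleaved if
  they have this form. For positive minors the Pluecker relation
  \<open>\<Delta>\<^sub>i\<^sub>k \<Delta>\<^sub>j\<^sub>l = \<Delta>\<^sub>i\<^sub>j \<Delta>\<^sub>k\<^sub>l + \<Delta>\<^sub>i\<^sub>l \<Delta>\<^sub>j\<^sub>k\<close>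
  says that uncrossing strictly decreases the product
  (\<open>pluecker_uncrossing\<close>). Hence two disjoint non-crossing edges cannot both attain the largest
  minor: the crossing pair on the same vertices would have a larger product.

  For the converse, start from the point with columns \<open>(cos t, sin t)\<close>, \<open>t = \<pi> k / n\<close>, whose
  minors are \<open>sin (\<pi> (l - k) / n)\<close>, and rescale column \<open>k\<close> by a positive radius \<open>r k\<close> so that the
  largest minors become exactly those of \<open>H\<close>. To find the radii, fix an edge \<open>{a, b}\<close> of \<open>H\<close>.
  Every other edge of \<open>H\<close> crosses it or meets it, so it joins the arc \<open>a, \<dots>, b\<close> to the complementary
  arc \<open>b, \<dots>, n, 1, \<dots>, a\<close>. Regard the first arc as the rows and the second as the columns of a
  grid. Then \<open>H\<close> becomes a chain of the grid in the product order, containing two opposite corners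
  that both stand for \<open>{a, b}\<close>, and by the Pluecker relation the sines form a strict inverse Monge
  array: an increasing pair of entries has a larger product than the decreasing pair on the same rows
  and columns. For such an array and any chain, rows and columns can be rescaled so that the
  entries of the chain become \<open>1\<close> and all others become smaller
  (\<open>monge_chain_tight_scaling\<close>); this is proved by peeling off the last row or column. The two
  scale factors obtained for \<open>a\<close> and for \<open>b\<close>, each of which is both a row and a column, agree after
  multiplying all rows by a constant and dividing all columns by it, because the two corners carry
  the same sine (\<open>glue_scalings\<close>). A pair of vertices outside the grid is disjoint from
  \<open>{a, b}\<close> and does not cross it, so uncrossing bounds its minor strictly by a product of two
  minors in the grid.

  The geometric notion of crossing for vertices on a circle is matched with interleaving by the
  orientations of triples of vertices, which are all the same for points in clockwise order.
\<close>

section \<open>Interleaved edges\<close>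

text \<open>Crossing expressed by the circular order of the labels alone. Equating the unordered pairs
  \<open>{e, f}\<close> makes the relation symmetric.\<close>

definition interleaved :: "nat set \<Rightarrow> nat set \<Rightarrow> bool" where
  "interleaved e f \<longleftrightarrow> (\<exists>i j k l. i < j \<and> j < k \<and> k < l \<and> {e, f} = {{i, k}, {j, l}})"

lemma two_subsetsE:
  assumes "e \<in> two_subsets n"
  obtains k l where "e = {k, l}" "k < l" "1 \<le> k" "l \<le> n"
proof -
  obtain x y where "e = {x, y}" "x \<noteq> y" "e \<subseteq> {1..n}"
    using assms by (auto simp: two_subsets_def card_2_iff)
  then show thesis
    using that[of x y] that[of y x] by (cases "x < y") (auto simp: insert_commute)
qed

lemma pair_in_two_subsets:
  "{k, l} \<in> two_subsets n \<longleftrightarrow> k \<noteq> l \<and> k \<in> {1..n} \<and> l \<in> {1..n}"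
  by (auto simp: two_subsets_def card_2_iff doubleton_eq_iff)

lemma interleaved_commute: "interleaved e f \<longleftrightarrow> interleaved f e"
  by (simp add: interleaved_def insert_commute)

lemma interleavedD:
  assumes "interleaved {a, b} {c, d}" "a < b" "c < d"
  shows "a < c \<and> c < b \<and> b < d \<or> c < a \<and> a < d \<and> d < b"
  using assms by (auto simp: interleaved_def doubleton_eq_iff)

lemma not_interleaved:
  assumes "i < j" "j < k" "k < l"
  shows "\<not> interleaved {i, j} {k, l}" "\<not> interleaved {i, l} {j, k}"
  using interleavedD[of i j k l] interleavedD[of i l j k] assms by linarith+

lemma disjoint_edges_cases:
  assumes "e \<in> two_subsets n" "f \<in> two_subsets n" "e \<inter> f = {}"
  obtains (cross) i j k l where "1 \<le> i" "i < j" "j < k" "k < l" "l \<le> n" "{e, f} = {{i, k}, {j, l}}"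
  | (apart) i j k l where "1 \<le> i" "i < j" "j < k" "k < l" "l \<le> n" "{e, f} = {{i, j}, {k, l}}"
  | (nested) i j k l where "1 \<le> i" "i < j" "j < k" "k < l" "l \<le> n" "{e, f} = {{i, l}, {j, k}}"
proof -
  obtain a b where e: "e = {a, b}" "a < b" "1 \<le> a" "b \<le> n" using assms(1) by (rule two_subsetsE)
  obtain c d where f: "f = {c, d}" "c < d" "1 \<le> c" "d \<le> n" using assms(2) by (rule two_subsetsE)
  have ne: "a \<noteq> c" "a \<noteq> d" "b \<noteq> c" "b \<noteq> d" using assms(3) e f by auto
  consider "b < c" | "a < c" "c < b" "b < d" | "a < c" "d < b"
    | "d < a" | "c < a" "a < d" "d < b" | "c < a" "b < d"
    using ne e f by linarith
  then show thesis
  proof cases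
    case 1 then show thesis using apart[of a b c d] e f by simp
  next
    case 2 then show thesis using cross[of a c b d] e f by simp
  next
    case 3 then show thesis using nested[of a c d b] e f by simp
  next
    case 4 then show thesis using apart[of c d a b] e f by (simp add: insert_commute)
  next
    case 5 then show thesis using cross[of c a d b] e f by (simp add: insert_commute)
  next
    case 6 then show thesis using nested[of c a b d] e f by (simp add: insert_commute)
  qed
qed

section \<open>Crossing chords of a circle\<close>

text \<open>Twice the signed area of the triangle \<open>x y z\<close>, counted positive if it is traversed clockwise.
  It vanishes for \<open>z\<close> on the line through \<open>x\<close> and \<open>y\<close> and is affine in \<open>z\<close>.\<close>

definition turn :: "complex \<Rightarrow> complex \<Rightarrow> complex \<Rightarrow> real" where
  "turn x y z = Im (y - x) * Re (z - x) - Re (y - x) * Im (z - x)"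

lemma turn_cyclic: "turn y z x = turn x y z"
  by (simp add: turn_def algebra_simps)

lemma turn_convex_combination:
  "turn x y ((1 - u) *\<^sub>R p + u *\<^sub>R q) = (1 - u) * turn x y p + u * turn x y q"
  by (simp add: turn_def algebra_simps)

text \<open>The line through \<open>a\<close> and \<open>b\<close> has the whole other segment strictly on one side.\<close>

lemma segments_disjoint:
  assumes "turn a b p > 0" "turn a b q > 0"
  shows "closed_segment a b \<inter> closed_segment p q = {}"
proof -
  have "turn a b z = 0" if "z \<in> closed_segment a b" for z
    using that by (auto simp: in_segment turn_convex_combination) (simp_all add: turn_def)
  moreover have "turn a b z > 0" if z: "z \<in> closed_segment p q" for z
  proof -
    obtain u where u: "0 \<le> u" "u \<le> 1" "z = (1 - u) *\<^sub>R p + u *\<^sub>R q"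
      using z by (auto simp: in_segment)
    then have "turn a b z = (1 - u) * turn a b p + u * turn a b q"
      by (simp add: turn_convex_combination)
    also have "\<dots> > 0"
      using u assms by (cases "u = 0") (auto intro!: add_nonneg_pos)
    finally show ?thesis .
  qed
  ultimately show ?thesis by fastforce
qed

text \<open>Any four points of the plane satisfy an affine relation whose coefficients are the signed areas
  of the triangles on the other three. If all areas have the same sign, the relation exhibits a point
  of \<open>[a, c]\<close> as a point of \<open>[b, d]\<close>.\<close>

lemma segments_meet:
  assumes "turn a b c > 0" "turn a b d > 0" "turn a c d > 0" "turn b c d > 0"
  shows "closed_segment a c \<inter> closed_segment b d \<noteq> {}"
proof -
  define S where "S = turn b c d + turn a b d"
  have S: "S > 0" "S = turn a c d + turn a b c"
    using assms by (auto simp: S_def turn_def algebra_simps)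
  define u v where "u = turn a b d / S" and "v = turn a b c / S"
  have u: "0 \<le> u" "u \<le> 1" "1 - u = turn b c d / S"
    using assms S(1) unfolding u_def by (auto simp: S_def field_simps)
  have v: "0 \<le> v" "v \<le> 1" "1 - v = turn a c d / S"
    using assms S(1) unfolding v_def by (auto simp: S(2) field_simps)
  have "turn b c d *\<^sub>R a + turn a b d *\<^sub>R c = turn a c d *\<^sub>R b + turn a b c *\<^sub>R d"
    by (rule complex_eqI) (simp_all add: turn_def algebra_simps)
  then have "(1/S) *\<^sub>R (turn b c d *\<^sub>R a + turn a b d *\<^sub>R c)
      = (1/S) *\<^sub>R (turn a c d *\<^sub>R b + turn a b c *\<^sub>R d)" by simp
  then have "(1 - u) *\<^sub>R a + u *\<^sub>R c = (1 - v) *\<^sub>R b + v *\<^sub>R d"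
    unfolding u(3) v(3) by (simp add: u_def v_def scaleR_add_right)
  then show ?thesis using u v by (fastforce simp: in_segment)
qed

text \<open>The sum of sines that the area formula gives on a circle factors into sines of half differences,
  which makes its sign visible.\<close>

lemma turn_on_circle:
  "turn (c + of_real r * cis (- \<alpha>)) (c + of_real r * cis (- \<beta>)) (c + of_real r * cis (- \<gamma>))
    = 4 * r\<^sup>2 * sin ((\<beta> - \<alpha>) / 2) * sin ((\<gamma> - \<beta>) / 2) * sin ((\<gamma> - \<alpha>) / 2)"
proof -
  define s t where "s = (\<beta> - \<alpha>) / 2" and "t = (\<gamma> - \<beta>) / 2"
  have st: "2 * s = \<beta> - \<alpha>" "2 * t = \<gamma> - \<beta>" "(\<gamma> - \<alpha>) / 2 = s + t" "2 * (s + t) = \<gamma> - \<alpha>"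
    by (simp_all add: s_def t_def field_simps)
  have "turn (c + of_real r * cis (- \<alpha>)) (c + of_real r * cis (- \<beta>)) (c + of_real r * cis (- \<gamma>))
      = r\<^sup>2 * (sin (\<beta> - \<alpha>) + sin (\<gamma> - \<beta>) - sin (\<gamma> - \<alpha>))"
    by (simp add: turn_def sin_diff power2_eq_square algebra_simps)
  also have "sin (\<beta> - \<alpha>) + sin (\<gamma> - \<beta>) - sin (\<gamma> - \<alpha>) = sin (2 * s) + sin (2 * t) - sin (2 * (s + t))"
    by (simp add: st)
  also have "\<dots> = 4 * sin s * sin t * sin (s + t)"
  proof -
    \<comment> \<open>The double angle formulas, with the error terms that \<open>sin\<^sup>2 + cos\<^sup>2 = 1\<close> makes vanish.\<close>
    have expand: "2 * a * b + 2 * c * d - 2 * (a * d + b * c) * (b * d - a * c)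
        = 4 * a * c * (a * d + b * c)
          + 2 * a * b * (1 - (c\<^sup>2 + d\<^sup>2)) + 2 * c * d * (1 - (a\<^sup>2 + b\<^sup>2))" for a b c d :: real
      by (simp add: algebra_simps power2_eq_square)
    show ?thesis
      unfolding sin_double sin_add cos_add
      using expand[of "sin s" "cos s" "sin t" "cos t"] by simp
  qed
  finally show ?thesis by (simp add: s_def[symmetric] t_def[symmetric] st)
qed

text \<open>The placement goes around less than once, so all half differences of angles lie strictly between
  \<open>0\<close> and \<open>\<pi>\<close>.\<close>

lemma clockwise_placement_turn:
  assumes "clockwise_placement n P" "1 \<le> i" "i < j" "j < k" "k \<le> n"
  shows "turn (P i) (P j) (P k) > 0"
proof -
  obtain c r \<theta> where r: "r > 0" and mono: "strict_mono_on {1..n} \<theta>"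
    and less: "\<theta> n < \<theta> 1 + 2 * pi"
    and P: "\<forall>k\<in>{1..n}. P k = c + of_real r * cis (- \<theta> k)"
    using assms(1) unfolding clockwise_placement_def by blast
  have lt: "\<theta> x < \<theta> y" if "1 \<le> x" "x < y" "y \<le> n" for x y
    using mono that by (auto simp: strict_mono_on_def)
  have le: "\<theta> x \<le> \<theta> y" if "1 \<le> x" "x \<le> y" "y \<le> n" for x y
    using lt[of x y] that by (cases "x = y") auto
  have pos: "sin ((\<theta> y - \<theta> x) / 2) > 0" if "1 \<le> x" "x < y" "y \<le> n" for x y
    using lt[OF that] le[of 1 x] le[of y n] that less by (intro sin_gt_zero) auto
  show ?thesis
    using assms P r pos[of i j] pos[of j k] pos[of i k] by (simp add: turn_on_circle)
qed

lemma crossing_commute: "crossing P e f \<longleftrightarrow> crossing P f e"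
proof -
  have "crossing P f e" if cross: "crossing P e f" for e f
  proof -
    obtain a b c d where "distinct [a, b, c, d]" "e = {a, b}" "f = {c, d}"
      "closed_segment (P a) (P b) \<inter> closed_segment (P c) (P d) \<noteq> {}"
      using cross unfolding crossing_def by blast
    then have "distinct [c, d, a, b] \<and> f = {c, d} \<and> e = {a, b} \<and>
        closed_segment (P c) (P d) \<inter> closed_segment (P a) (P b) \<noteq> {}"
      by (auto simp: Int_commute)
    then show ?thesis unfolding crossing_def by blast
  qed
  then show ?thesis by blast
qed

lemma crossing_pairs:
  assumes "distinct [a, b, c, d]"
  shows "crossing P {a, b} {c, d} \<longleftrightarrow>
    closed_segment (P a) (P b) \<inter> closed_segment (P c) (P d) \<noteq> {}"
proof
  assume "crossing P {a, b} {c, d}"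
  then obtain a' b' c' d' where "{a, b} = {a', b'}" "{c, d} = {c', d'}"
    "closed_segment (P a') (P b') \<inter> closed_segment (P c') (P d') \<noteq> {}"
    unfolding crossing_def by blast
  then show "closed_segment (P a) (P b) \<inter> closed_segment (P c) (P d) \<noteq> {}"
    by (metis doubleton_eq_iff closed_segment_commute)
next
  assume "closed_segment (P a) (P b) \<inter> closed_segment (P c) (P d) \<noteq> {}"
  then show "crossing P {a, b} {c, d}" unfolding crossing_def
    using assms by (intro exI[of _ a] exI[of _ b] exI[of _ c] exI[of _ d]) simp
qed

text \<open>All triples in increasing order turn the same way. For interleaved edges this makes the segments
  meet. For edges that are apart or nested, both ends of one lie on the same side of the other; in the
  nested case this needs the chord \<open>[j, k]\<close> as the separating one and a cyclic rotation of
  the triple \<open>i, j, k\<close>.\<close>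

lemma crossing_iff_interleaved:
  assumes P: "clockwise_placement n P"
    and ef: "e \<in> two_subsets n" "f \<in> two_subsets n" "e \<inter> f = {}"
  shows "crossing P e f \<longleftrightarrow> interleaved e f"
  using ef
proof (cases rule: disjoint_edges_cases)
  case (cross i j k l)
  have ef: "e = {i, k} \<and> f = {j, l} \<or> e = {j, l} \<and> f = {i, k}"
    using cross(6) by (simp only: doubleton_eq_iff)
  have "closed_segment (P i) (P k) \<inter> closed_segment (P j) (P l) \<noteq> {}"
    using cross P by (intro segments_meet) (auto intro: clockwise_placement_turn)
  then have "crossing P {i, k} {j, l}" using cross by (subst crossing_pairs) auto
  then have "crossing P e f" using ef crossing_commute by metis
  moreover have "interleaved e f" using cross by (auto simp: interleaved_def)
  ultimately show ?thesis by simp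
next
  case (apart i j k l)
  have ef: "e = {i, j} \<and> f = {k, l} \<or> e = {k, l} \<and> f = {i, j}"
    using apart(6) by (simp only: doubleton_eq_iff)
  have "closed_segment (P i) (P j) \<inter> closed_segment (P k) (P l) = {}"
    using apart P by (intro segments_disjoint) (auto intro: clockwise_placement_turn)
  then have "\<not> crossing P {i, j} {k, l}" using apart by (subst crossing_pairs) auto
  then have "\<not> crossing P e f" using ef crossing_commute by metis
  moreover have "\<not> interleaved e f"
    using not_interleaved[OF apart(2-4)] interleaved_commute ef by metis
  ultimately show ?thesis by simp
next
  case (nested i j k l)
  have ef: "e = {i, l} \<and> f = {j, k} \<or> e = {j, k} \<and> f = {i, l}"
    using nested(6) by (simp only: doubleton_eq_iff)
  have "turn (P j) (P k) (P i) > 0"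
    using nested P by (subst turn_cyclic) (auto intro: clockwise_placement_turn)
  then have "closed_segment (P j) (P k) \<inter> closed_segment (P i) (P l) = {}"
    using nested P by (intro segments_disjoint) (auto intro: clockwise_placement_turn)
  then have "\<not> crossing P {j, k} {i, l}" using nested by (subst crossing_pairs) auto
  then have "\<not> crossing P e f" using ef crossing_commute by metis
  moreover have "\<not> interleaved e f"
    using not_interleaved[OF nested(2-4)] interleaved_commute ef by metis
  ultimately show ?thesis by simp
qed

section \<open>Minors and the positive Grassmannian\<close>

lemma det_2x2:
  fixes B :: "real mat"
  assumes "B \<in> carrier_mat 2 2"
  shows "det B = B $$ (0,0) * B $$ (1,1) - B $$ (0,1) * B $$ (1,0)"
proof -
  have cof: "cofactor B 0 0 = B $$ (1,1)" "cofactor B 1 0 = - B $$ (0,1)"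
    using assms by (auto simp: cofactor_def mat_delete_def det_single)
  have "det B = (\<Sum>i<2. B $$ (i,0) * cofactor B i 0)"
    using laplace_expansion_column[OF assms, of 0] by simp
  also have "\<dots> = B $$ (0,0) * cofactor B 0 0 + B $$ (1,0) * cofactor B 1 0"
    by (simp add: numeral_2_eq_2)
  finally show ?thesis unfolding cof by (simp add: algebra_simps)
qed

lemma minor2_pair:
  assumes "A \<in> carrier_mat 2 n" "k < l" "1 \<le> k" "l \<le> n"
  shows "minor2 A {k, l} = A $$ (0,k-1) * A $$ (1,l-1) - A $$ (0,l-1) * A $$ (1,k-1)"
proof -
  have "Min {k,l} = k" "Max {k,l} = l" using assms by auto
  moreover have "mat_of_cols 2 [col A (k-1), col A (l-1)] \<in> carrier_mat 2 2"
    by auto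
  ultimately show ?thesis using assms
    unfolding minor2_def by (simp add: det_2x2 mat_of_cols_def)
qed

lemma minor2_mult_left:
  assumes "A \<in> carrier_mat 2 n" "g \<in> carrier_mat 2 2" "I \<in> two_subsets n"
  shows "minor2 (g * A) I = det g * minor2 A I"
proof -
  obtain k l where kl: "I = {k,l}" "k < l" "1 \<le> k" "l \<le> n"
    using assms(3) by (rule two_subsetsE)
  have "g * A \<in> carrier_mat 2 n" using assms by simp
  then show ?thesis using assms kl
    by (simp add: minor2_pair[OF _ kl(2-4)] det_2x2 scalar_prod_def numeral_2_eq_2 algebra_simps)
qed

text \<open>The two columns of the minor are linearly independent, which bounds the rank from below; the height
  of the matrix bounds it from above.\<close>

lemma rank_2_if_minor2_nonzero:
  fixes A :: "real mat"
  assumes A: "A \<in> carrier_mat 2 n" and kl: "k < l" "1 \<le> k" "l \<le> n"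
    and nz: "minor2 A {k, l} \<noteq> 0"
  shows "vec_space.rank 2 A = 2"
proof -
  interpret vec_space "TYPE(real)" 2 .
  define B where "B = mat_of_cols 2 [col A (k-1), col A (l-1)]"
  have B: "B \<in> carrier_mat 2 2" by (auto simp: B_def)
  have "col A m \<in> carrier_vec 2" for m using A col_dim[of A m] by simp
  then have cols: "cols B = [col A (k-1), col A (l-1)]"
    unfolding B_def by (intro cols_mat_of_cols) auto
  have "Min {k,l} = k" "Max {k,l} = l" using kl by auto
  then have "det B \<noteq> 0" using nz by (simp add: minor2_def B_def)
  then have rB: "rank B = 2" using det_rank_iff[OF B] by simp
  have "distinct (cols B)"
    using non_distinct_low_rank[OF B] rB by linarith
  then have "card (set (cols B)) = 2" by (simp add: distinct_card cols)
  moreover have "lin_indpt (set (cols B))"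
    using full_rank_lin_indpt[OF B rB] \<open>distinct (cols B)\<close> by simp
  moreover have "set (cols B) \<subseteq> set (cols A)"
    using A kl unfolding cols by (auto simp: cols_def)
  ultimately have "2 \<le> rank A"
    using rank_ge_card_indpt[OF A] by metis
  moreover have "rank A \<le> 2"
  proof -
    have S: "set (cols A) \<subseteq> carrier_vec 2" using cols_dim[of A] A by auto
    have "subspace class_ring (span (set (cols A))) V"
      using span_is_subspace S by auto
    then show ?thesis
      using subspace_dim[OF _ fin_dim fin_dim_span_cols[OF A]] dim_is_n
      unfolding rank_def by simp
  qed
  ultimately show ?thesis by simp
qed

lemma row_equiv_self:
  assumes "A \<in> rank2_mats n"
  shows "(A, A) \<in> row_equiv n"
proof -
  have "1\<^sub>m 2 * A = A" using assms by (auto simp: rank2_mats_def)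
  moreover have "invertible_mat (1\<^sub>m 2 :: real mat)"
    unfolding invertible_mat_def inverts_mat_def by (auto intro: exI[of _ "1\<^sub>m 2"])
  ultimately show ?thesis using assms unfolding row_equiv_def
    by (auto intro!: bexI[of _ "1\<^sub>m 2"])
qed

lemma det_nonzero_if_invertible:
  fixes g :: "real mat"
  assumes "g \<in> carrier_mat 2 2" "invertible_mat g"
  shows "det g \<noteq> 0"
proof -
  obtain h where h: "g * h = 1\<^sub>m 2" "h * g = 1\<^sub>m (dim_row h)"
    using assms by (auto simp: invertible_mat_def inverts_mat_def)
  have "dim_col h = 2" using h(1) by (metis index_mult_mat(3) index_one_mat(3))
  moreover have "dim_row h = 2" using h(2) assms(1)
    by (metis carrier_matD(2) index_mult_mat(3) index_one_mat(3))
  ultimately have "h \<in> carrier_mat 2 2" by auto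
  then have "det g * det h = 1" using h(1) assms(1) by (metis det_mult det_one)
  then show ?thesis by auto
qed

text \<open>A row operation multiplies all minors by its determinant, so one representative with positive
  minors suffices.\<close>

lemma row_class_in_Gr_pos:
  assumes A: "A \<in> rank2_mats n" and pos: "\<And>I. I \<in> two_subsets n \<Longrightarrow> minor2 A I > 0"
  shows "row_equiv n `` {A} \<in> Gr_pos n"
proof -
  have "(\<forall>I\<in>two_subsets n. minor2 B I > 0) \<or> (\<forall>I\<in>two_subsets n. minor2 B I < 0)"
    if "(A, B) \<in> row_equiv n" for B
  proof -
    obtain g where g: "g \<in> carrier_mat 2 2" "invertible_mat g" "B = g * A"
      using \<open>(A, B) \<in> row_equiv n\<close> by (auto simp: row_equiv_def)
    have "minor2 B I = det g * minor2 A I" if "I \<in> two_subsets n" for I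
      using minor2_mult_left[OF _ g(1) that] g(3) A by (simp add: rank2_mats_def)
    moreover have "det g > 0 \<or> det g < 0"
      using det_nonzero_if_invertible g by fastforce
    ultimately show ?thesis using pos by (auto simp: mult_neg_pos)
  qed
  then show ?thesis using A by (auto simp: Gr_pos_def intro: quotientI)
qed

lemma Gr_pos_member_carrier:
  assumes "X \<in> Gr_pos n" "A \<in> X"
  shows "A \<in> carrier_mat 2 n"
  using assms by (auto simp: Gr_pos_def quotient_def row_equiv_def rank2_mats_def)

section \<open>Uncrossing by the Pluecker relation\<close>

text \<open>Both summands on the right of the Pluecker relation are positive, so each is smaller than the
  product for the crossing pair. The pairs \<open>{a, c}\<close> and \<open>{b, d}\<close> in the conclusion both join the two
  given edges.\<close>

lemma pluecker_uncrossing: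
  fixes D :: "nat \<Rightarrow> nat \<Rightarrow> real"
  assumes sym: "\<And>k l. D k l = D l k"
    and pos: "\<And>k l. 1 \<le> k \<Longrightarrow> k < l \<Longrightarrow> l \<le> n \<Longrightarrow> D k l > 0"
    and pluecker: "\<And>i j k l. 1 \<le> i \<Longrightarrow> i < j \<Longrightarrow> j < k \<Longrightarrow> k < l \<Longrightarrow> l \<le> n \<Longrightarrow>
      D i k * D j l = D i j * D k l + D i l * D j k"
    and ef: "e \<in> two_subsets n" "f \<in> two_subsets n" "e \<inter> f = {}" "\<not> interleaved e f"
  shows "\<exists>a b c d. e = {a, b} \<and> f = {c, d} \<and> D a b * D c d < D a c * D b d"
  using ef(1-3)
proof (cases rule: disjoint_edges_cases)
  case (cross i j k l)
  then have "interleaved e f" unfolding interleaved_def by blast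
  then show ?thesis using ef(4) by blast
next
  case (apart i j k l)
  have "D i l * D j k > 0" using pos[of i l] pos[of j k] apart by simp
  then have "D i j * D k l < D i k * D j l" using pluecker[of i j k l] apart by simp
  then have less: "D i j * D k l < D i k * D j l" "D k l * D i j < D k i * D l j"
    using sym by (simp_all add: mult.commute)
  have "e = {i, j} \<and> f = {k, l} \<or> e = {k, l} \<and> f = {i, j}"
    using apart(6) by (simp only: doubleton_eq_iff)
  then show ?thesis using less by blast
next
  case (nested i j k l)
  have "D i j * D k l > 0" using pos[of i j] pos[of k l] nested by simp
  then have "D i l * D j k < D i k * D j l" using pluecker[of i j k l] nested by simp
  then have less: "D i l * D k j < D i k * D l j" "D k j * D i l < D k i * D j l"
    using sym[of k j] sym[of l j] sym[of k i] by (simp_all add: mult.commute)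
  have "e = {i, l} \<and> f = {k, j} \<or> e = {k, j} \<and> f = {i, l}"
    using nested(6) by (simp only: doubleton_eq_iff insert_commute)
  then show ?thesis using less by blast
qed

lemma minor2_pluecker:
  assumes "A \<in> carrier_mat 2 n" "1 \<le> i" "i < j" "j < k" "k < l" "l \<le> n"
  shows "minor2 A {i, k} * minor2 A {j, l} =
    minor2 A {i, j} * minor2 A {k, l} + minor2 A {i, l} * minor2 A {j, k}"
  using assms by (simp add: minor2_pair algebra_simps)

text \<open>If both edges attain the largest minor \<open>m\<close>, uncrossing gives two minors whose product exceeds
  \<open>m\<^sup>2\<close>.\<close>

lemma arrangement_imp_interleaved:
  assumes "arrangement_of_largest_minors n H" "e \<in> H" "f \<in> H" "e \<inter> f = {}"
  shows "interleaved e f"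
proof (rule ccontr)
  assume not: "\<not> interleaved e f"
  obtain X A where A: "X \<in> Gr_pos n" "A \<in> X"
    and H: "H \<subseteq> two_subsets n"
    and pos: "\<forall>I\<in>two_subsets n. minor2 A I > 0"
    and eq: "\<forall>I\<in>H. \<forall>I'\<in>H. minor2 A I = minor2 A I'"
    and less: "\<forall>I\<in>H. \<forall>K\<in>two_subsets n - H. minor2 A K < minor2 A I"
    using assms(1) unfolding arrangement_of_largest_minors_def by blast
  have carr: "A \<in> carrier_mat 2 n" using Gr_pos_member_carrier A .
  have ef: "e \<in> two_subsets n" "f \<in> two_subsets n" using H assms by auto
  have "\<exists>a b c d. e = {a, b} \<and> f = {c, d} \<and>
      minor2 A {a, b} * minor2 A {c, d} < minor2 A {a, c} * minor2 A {b, d}"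
  proof (rule pluecker_uncrossing[OF _ _ _ ef assms(4) not])
    show "minor2 A {k, l} = minor2 A {l, k}" for k l by (simp add: insert_commute)
    show "minor2 A {k, l} > 0" if "1 \<le> k" "k < l" "l \<le> n" for k l
      using pos that by (simp add: pair_in_two_subsets)
  qed (rule minor2_pluecker[OF carr])
  then obtain a b c d where abcd: "e = {a, b}" "f = {c, d}"
    "minor2 A {a, b} * minor2 A {c, d} < minor2 A {a, c} * minor2 A {b, d}" by blast
  have max: "minor2 A K \<le> minor2 A e" if "K \<in> two_subsets n" for K
  proof (cases "K \<in> H")
    case True
    then have "minor2 A K = minor2 A e" using eq assms(2) by blast
    then show ?thesis by simp
  next
    case False
    then have "minor2 A K < minor2 A e" using less assms(2) that by blast
    then show ?thesis by simp
  qed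
  have ac: "{a, c} \<in> two_subsets n" and bd: "{b, d} \<in> two_subsets n"
    using ef assms(4) by (auto simp: abcd(1,2) pair_in_two_subsets)
  have "minor2 A {a, c} * minor2 A {b, d} \<le> minor2 A e * minor2 A e"
  proof (rule mult_mono)
    show "0 \<le> minor2 A e" "0 \<le> minor2 A {b, d}" using pos ef(1) bd by (simp_all add: less_imp_le)
  qed (use max ac bd in blast)+
  also have "\<dots> = minor2 A e * minor2 A f"
    using eq assms(2,3) by metis
  finally show False using abcd by simp
qed

section \<open>Tight scalings of Monge arrays along a chain\<close>

text \<open>A nonnegative \<open>p \<times> q\<close> array with the strict inverse Monge condition, together with a set \<open>E\<close>
  of positive entries whose positions form a chain in the product order. Zero entries must be
  allowed: in the application the two corners off the main diagonal vanish.\<close>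

definition monge_chain :: "nat \<Rightarrow> nat \<Rightarrow> (nat \<Rightarrow> nat \<Rightarrow> real) \<Rightarrow> (nat \<times> nat) set \<Rightarrow> bool" where
  "monge_chain p q M E \<longleftrightarrow>
     (\<forall>i<p. \<forall>j<q. 0 \<le> M i j \<and> ((i, j) \<in> E \<longrightarrow> 0 < M i j)) \<and>
     (\<forall>i' < p. \<forall>j' < q. \<forall>i<i'. \<forall>j<j'.
        M i j' * M i' j < M i j * M i' j' \<and> \<not> ((i, j') \<in> E \<and> (i', j) \<in> E))"

definition tight_scaling ::
  "nat \<Rightarrow> nat \<Rightarrow> (nat \<Rightarrow> nat \<Rightarrow> real) \<Rightarrow> (nat \<times> nat) set \<Rightarrow> (nat \<Rightarrow> real) \<Rightarrow> (nat \<Rightarrow> real) \<Rightarrow> bool" where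
  "tight_scaling p q M E x y \<longleftrightarrow> (\<forall>i. x i > 0) \<and> (\<forall>j. y j > 0) \<and>
     (\<forall>i<p. \<forall>j<q. x i * y j * M i j \<le> 1 \<and> (x i * y j * M i j = 1 \<longleftrightarrow> (i, j) \<in> E))"

lemma monge_chain_transpose:
  "monge_chain q p (\<lambda>j i. M i j) (E\<inverse>) \<longleftrightarrow> monge_chain p q M E"
  unfolding monge_chain_def by (auto simp: mult.commute)

lemma tight_scaling_transpose:
  "tight_scaling q p (\<lambda>j i. M i j) (E\<inverse>) y x \<longleftrightarrow> tight_scaling p q M E x y"
  unfolding tight_scaling_def by (auto simp: mult.commute mult.left_commute)

lemma monge_chain_mono:
  assumes "monge_chain p q M E" "p' \<le> p" "q' \<le> q"
  shows "monge_chain p' q' M E"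
  using assms unfolding monge_chain_def by (meson less_le_trans)

lemma finite_scale_below_1:
  fixes c :: "nat \<Rightarrow> real"
  shows "\<exists>s>0. \<forall>j<q. s * c j < 1"
proof -
  define C where "C = (\<Sum>j<q. \<bar>c j\<bar>) + 1"
  have C: "C > 0" unfolding C_def by (smt (verit) sum_nonneg)
  have "c j < C" if "j < q" for j
  proof -
    have "\<bar>c j\<bar> \<le> (\<Sum>j<q. \<bar>c j\<bar>)" using that by (intro member_le_sum) auto
    then show ?thesis unfolding C_def by linarith
  qed
  then show ?thesis using C by (intro exI[of _ "1 / C"]) auto
qed

text \<open>If the new row contains no entry of \<open>E\<close>, a small factor for it will do. Otherwise its only
  entry of \<open>E\<close> is the last one, and its factor is forced; that the remaining entries of the row stay
  below \<open>1\<close> follows by comparing them, through the Monge condition, with an earlier row that is tight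
  in the last column.\<close>

lemma tight_scaling_add_row:
  assumes M: "monge_chain (Suc p) q M E" and t: "tight_scaling p q M E x y"
    and E: "(\<forall>j<q. (p, j) \<notin> E) \<or>
      (\<exists>q'. q = Suc q' \<and> (p, q') \<in> E \<and> (\<exists>i<p. (i, q') \<in> E))"
  shows "\<exists>x'. tight_scaling (Suc p) q M E x' y"
proof -
  have ypos: "y j > 0" for j using t by (simp add: tight_scaling_def)
  obtain s where s: "s > 0"
    "\<forall>j<q. s * y j * M p j \<le> 1 \<and> (s * y j * M p j = 1 \<longleftrightarrow> (p, j) \<in> E)"
    using E
  proof (elim disjE exE conjE)
    assume *: "\<forall>j<q. (p, j) \<notin> E"
    obtain s where "s > 0" "\<forall>j<q. s * (y j * M p j) < 1"
      using finite_scale_below_1[of q "\<lambda>j. y j * M p j"] by blast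
    then show thesis using * by (intro that[of s]) (auto simp: mult.assoc less_imp_le)
  next
    fix q' i assume q': "q = Suc q'" "(p, q') \<in> E" and i: "i < p" "(i, q') \<in> E"
    have pos: "M p q' > 0" using M q' by (auto simp: monge_chain_def)
    define s where "s = 1 / (y q' * M p q')"
    have "s * y j * M p j < 1 \<and> (p, j) \<notin> E" if "j < q'" for j
    proof -
      have strict: "M i q' * M p j < M i j * M p q'" and not: "(p, j) \<notin> E"
        using M q' i \<open>j < q'\<close> unfolding monge_chain_def by blast+
      have tij: "x i * y j * M i j \<le> 1" and tiq: "x i * y q' * M i q' = 1" and xi: "x i > 0"
        using t q' i \<open>j < q'\<close> unfolding tight_scaling_def by (auto simp: less_Suc_eq)
      have "x i * (y j * M i j) \<le> x i * (y q' * M i q')"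
        using tij tiq by (simp add: mult.assoc)
      then have le: "y j * M i j \<le> y q' * M i q'" using xi by simp
      have Mi: "M i q' > 0" using M q' i by (auto simp: monge_chain_def)
      have "(y j * M p j) * M i q' < (y j * M i j) * M p q'"
        using strict ypos[of j] by (simp add: mult.commute mult.left_commute)
      also have "\<dots> \<le> (y q' * M i q') * M p q'" using le pos by simp
      also have "\<dots> = (y q' * M p q') * M i q'" by simp
      finally have "y j * M p j < y q' * M p q'" using Mi by simp
      then show ?thesis using not pos ypos[of q'] by (simp add: s_def)
    qed
    moreover have "s * y q' * M p q' = 1" "s > 0" using pos ypos[of q'] by (simp_all add: s_def)
    ultimately have "s * y j * M p j \<le> 1 \<and> (s * y j * M p j = 1 \<longleftrightarrow> (p, j) \<in> E)" if "j < q" for j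
      using that q' by (cases "j = q'") (simp_all add: less_Suc_eq less_imp_le less_imp_neq)
    then show thesis using that[of s] \<open>s > 0\<close> by blast
  qed
  have "tight_scaling (Suc p) q M E (x(p := s)) y"
    using t s unfolding tight_scaling_def by (auto simp: less_Suc_eq)
  then show ?thesis by blast
qed

text \<open>If the new corner is the only entry of \<open>E\<close> in its row and in its column, the factors \<open>s\<close> of the
  row and \<open>r\<close> of the column must satisfy \<open>s P < 1\<close>, \<open>r Q < 1\<close> and \<open>s r m = 1\<close>, where \<open>P\<close> and \<open>Q\<close>
  are the maxima of the already scaled new row and column and \<open>m\<close> is the corner entry. This is
  possible since \<open>P Q < m\<close>, which the Monge condition gives.\<close>

lemma tight_scaling_add_corner:
  assumes M: "monge_chain (Suc p) (Suc q) M E" and t: "tight_scaling p q M E x y"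
    and E: "(p, q) \<in> E" "\<forall>j<q. (p, j) \<notin> E" "\<forall>i<p. (i, q) \<notin> E"
  shows "\<exists>x' y'. tight_scaling (Suc p) (Suc q) M E x' y'"
proof -
  have xpos: "x i > 0" and ypos: "y j > 0" for i j using t by (simp_all add: tight_scaling_def)
  define m where "m = M p q"
  have m: "m > 0" using M E by (auto simp: monge_chain_def m_def)
  define P where "P = Max (insert 0 ((\<lambda>j. y j * M p j) ` {..<q}))"
  define Q where "Q = Max (insert 0 ((\<lambda>i. x i * M i q) ` {..<p}))"
  have P0: "P \<ge> 0" and Q0: "Q \<ge> 0" by (auto simp: P_def Q_def)
  have P: "y j * M p j \<le> P" if "j < q" for j using that by (auto simp: P_def intro!: Max_ge)
  have Q: "x i * M i q \<le> Q" if "i < p" for i using that by (auto simp: Q_def intro!: Max_ge)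
  have Pin: "P = 0 \<or> (\<exists>j<q. P = y j * M p j)"
    using Max_in[of "insert 0 ((\<lambda>j. y j * M p j) ` {..<q})"] by (auto simp: P_def)
  have Qin: "Q = 0 \<or> (\<exists>i<p. Q = x i * M i q)"
    using Max_in[of "insert 0 ((\<lambda>i. x i * M i q) ` {..<p})"] by (auto simp: Q_def)
  have "P * Q < m"
  proof (cases "P = 0 \<or> Q = 0")
    case True then show ?thesis using m by auto
  next
    case False
    then obtain i j where ij: "i < p" "j < q" "P = y j * M p j" "Q = x i * M i q"
      using Pin Qin by blast
    have "M i q * M p j < M i j * m" using M ij by (auto simp: monge_chain_def m_def)
    then have "(x i * y j) * (M i q * M p j) < (x i * y j) * (M i j * m)"
      using xpos[of i] ypos[of j] by simp
    moreover have "x i * y j * M i j * m \<le> 1 * m"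
      using t ij m by (intro mult_right_mono) (auto simp: tight_scaling_def)
    ultimately show ?thesis using ij by (simp add: mult_ac)
  qed
  \<comment> \<open>The row factor is \<open>1 / u\<close>; its bound and the one on the column factor \<open>u / m\<close> read
    \<open>P < u\<close> and \<open>u Q < m\<close>.\<close>
  obtain u where u: "P < u" "u * Q < m" "u > 0"
  proof (cases "Q = 0")
    case True then show thesis using that[of "P + 1"] m P0 by simp
  next
    case False
    then have "P < m / Q" using \<open>P * Q < m\<close> Q0 by (simp add: pos_less_divide_eq)
    then obtain u where "P < u" "u < m / Q" using dense by blast
    then show thesis using that[of u] False Q0 P0 by (simp add: pos_less_divide_eq)
  qed
  define s where "s = 1 / u"
  define r where "r = u / m"
  have sr: "s > 0" "r > 0" "s * r * m = 1" using u m by (simp_all add: s_def r_def)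
  have row: "s * y j * M p j < 1" if "j < q" for j
  proof -
    have "y j * M p j < u" using P[OF that] u by simp
    then show ?thesis using u by (simp add: s_def)
  qed
  have col: "x i * r * M i q < 1" if "i < p" for i
  proof -
    have "u * (x i * M i q) \<le> u * Q" using Q[OF that] u by simp
    then have "u * (x i * M i q) < m" using u(2) by linarith
    then show ?thesis using m by (simp add: r_def mult_ac)
  qed
  have "(x(p := s)) i * (y(q := r)) j * M i j \<le> 1 \<and>
      ((x(p := s)) i * (y(q := r)) j * M i j = 1 \<longleftrightarrow> (i, j) \<in> E)"
    if "i < Suc p" "j < Suc q" for i j
  proof (cases "i = p"; cases "j = q")
    assume "i = p" "j = q"
    then show ?thesis using E sr by (simp add: m_def)
  next
    assume *: "i = p" "j \<noteq> q"
    then have "j < q" using that by simp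
    then show ?thesis using row[of j] E * by simp
  next
    assume *: "i \<noteq> p" "j = q"
    then have "i < p" using that by simp
    then show ?thesis using col[of i] E * by simp
  next
    assume "i \<noteq> p" "j \<noteq> q"
    then show ?thesis using t that by (simp add: tight_scaling_def)
  qed
  then have "tight_scaling (Suc p) (Suc q) M E (x(p := s)) (y(q := r))"
    using xpos ypos sr by (simp add: tight_scaling_def)
  then show ?thesis by blast
qed

text \<open>Since \<open>E\<close> is a chain, the last row or the last column is free of it, or it contains the last
  corner and at most one of the last row and column has a further entry. In each case one of the
  previous two lemmas extends a scaling of the smaller array, up to transposition.\<close>

lemma monge_chain_tight_scaling:
  assumes "monge_chain p q M E"
  shows "\<exists>x y. tight_scaling p q M E x y"
  using assms
proof (induction "p + q" arbitrary: p q rule: less_induct)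
  case less
  show ?case
  proof (cases "p = 0 \<or> q = 0")
    case True
    then have "tight_scaling p q M E (\<lambda>_. 1) (\<lambda>_. 1)" by (auto simp: tight_scaling_def)
    then show ?thesis by blast
  next
    case False
    then obtain p' q' where pq: "p = Suc p'" "q = Suc q'" by (meson not0_implies_Suc)
    have chain: "\<not> ((i, q') \<in> E \<and> (p', j) \<in> E)" if "i < p'" "j < q'" for i j
      using less.prems that pq unfolding monge_chain_def by blast
    have mono: "monge_chain a b M E" if "a \<le> p" "b \<le> q" for a b
      using monge_chain_mono[OF less.prems that] .
    have row: ?thesis if "(\<forall>j<q. (p', j) \<notin> E) \<or> (p', q') \<in> E \<and> (\<exists>i<p'. (i, q') \<in> E)"
    proof -
      obtain x y where "tight_scaling p' q M E x y"
        using less.hyps[of p' q] mono[of p' q] pq by auto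
      then show ?thesis
        using tight_scaling_add_row[of p' q M E x y] that less.prems pq by blast
    qed
    have col: ?thesis if "(\<forall>i<p. (i, q') \<notin> E) \<or> (p', q') \<in> E \<and> (\<exists>j<q'. (p', j) \<in> E)"
    proof -
      obtain x y where "tight_scaling p q' M E x y"
        using less.hyps[of p q'] mono[of p q'] pq by auto
      then have "tight_scaling q' p (\<lambda>j i. M i j) (E\<inverse>) y x" by (simp add: tight_scaling_transpose)
      moreover have "monge_chain (Suc q') p (\<lambda>j i. M i j) (E\<inverse>)"
        using less.prems pq by (simp add: monge_chain_transpose)
      moreover have "(\<forall>i<p. (q', i) \<notin> E\<inverse>) \<or>
          (\<exists>p'. p = Suc p' \<and> (q', p') \<in> E\<inverse> \<and> (\<exists>j<q'. (j, p') \<in> E\<inverse>))"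
        using that pq by auto
      ultimately obtain y' where "tight_scaling (Suc q') p (\<lambda>j i. M i j) (E\<inverse>) y' x"
        using tight_scaling_add_row by blast
      then show ?thesis using tight_scaling_transpose pq by blast
    qed
    have corner: ?thesis if "(p', q') \<in> E" "\<forall>j<q'. (p', j) \<notin> E" "\<forall>i<p'. (i, q') \<notin> E"
    proof -
      obtain x y where "tight_scaling p' q' M E x y"
        using less.hyps[of p' q'] mono[of p' q'] pq by auto
      then show ?thesis
        using tight_scaling_add_corner[of p' q' M E x y] that less.prems pq by blast
    qed
    show ?thesis
    proof (cases "(p', q') \<in> E")
      case True
      then show ?thesis using row col corner by blast
    next
      case False
      have "(\<forall>j<q. (p', j) \<notin> E) \<or> (\<forall>i<p. (i, q') \<notin> E)"
        using chain False pq by (auto simp: less_Suc_eq)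
      then show ?thesis using row col by blast
    qed
  qed
qed

section \<open>Radii for the vertices\<close>

text \<open>Positions \<open>n + 1, n + 2, \<dots>\<close> continue around the circle.\<close>

definition vertex_at :: "nat \<Rightarrow> nat \<Rightarrow> nat" where
  "vertex_at n m = (if m \<le> n then m else m - n)"

text \<open>The minor of the columns \<open>(cos t, sin t)\<close> with \<open>t = \<pi> k / n\<close> and \<open>t = \<pi> l / n\<close>.\<close>

definition chord_sine :: "nat \<Rightarrow> nat \<Rightarrow> nat \<Rightarrow> real" where
  "chord_sine n k l = sin (pi * real l / n - pi * real k / n)"

lemma chord_sine_pos:
  assumes "k < l" "l < k + n"
  shows "chord_sine n k l > 0"
proof -
  have n: "n > 0" using assms by linarith
  have "pi * real l < pi * (real k + real n)" using assms by simp
  then have "pi * real l / n - pi * real k / n < pi" using n by (simp add: field_simps)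
  moreover have "0 < pi * real l / n - pi * real k / n"
    using assms n by (simp add: divide_strict_right_mono)
  ultimately show ?thesis unfolding chord_sine_def by (intro sin_gt_zero) auto
qed

text \<open>Going once around the circle through \<open>n\<close> positions corresponds to a half turn of the column
  vector, so the position of \<open>k\<close> after one round has the opposite column.\<close>

lemma chord_sine_around:
  assumes "n > 0"
  shows "chord_sine n l (k + n) = chord_sine n k l"
proof -
  have "pi * real (k + n) / n - pi * real l / n = pi - (pi * real l / n - pi * real k / n)"
    using assms by (simp add: field_simps)
  then show ?thesis unfolding chord_sine_def by (simp only: sin_pi_minus)
qed

lemma chord_sine_nonneg:
  assumes "k \<le> l" "l \<le> k + n"
  shows "chord_sine n k l \<ge> 0"
proof (cases "l = k \<or> n = 0")
  case True
  then show ?thesis using assms by (auto simp: chord_sine_def)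
next
  case False
  show ?thesis
  proof (cases "l = k + n")
    case True
    then have "chord_sine n k l = chord_sine n k k" using False by (simp add: chord_sine_around)
    then show ?thesis by (simp add: chord_sine_def)
  next
    case False
    then show ?thesis using chord_sine_pos[of k l n] assms \<open>\<not> (l = k \<or> n = 0)\<close> by simp
  qed
qed

lemma chord_sine_pluecker:
  "chord_sine n i k * chord_sine n j l =
    chord_sine n i j * chord_sine n k l + chord_sine n i l * chord_sine n j k"
  by (simp add: chord_sine_def sin_diff algebra_simps)

text \<open>The Monge condition is the Pluecker relation for the positions
  \<open>a + i < a + i' \<le> b + j < b + j'\<close>, with the summand that is always positive dropped. Two
  edges of \<open>H\<close> whose grid positions are not comparable would be disjoint and either nested or apart;
  which of these depends on how many of the two column positions lie beyond \<open>n\<close>.\<close>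

lemma chord_grid_monge_chain:
  assumes ab: "1 \<le> a" "a < b" "b \<le> n" and H: "H \<subseteq> two_subsets n"
    and cross: "\<And>e f. e \<in> H \<Longrightarrow> f \<in> H \<Longrightarrow> e \<inter> f = {} \<Longrightarrow> interleaved e f"
  shows "monge_chain (Suc (b - a)) (Suc (a + n - b)) (\<lambda>i j. chord_sine n (a + i) (b + j))
    {(i, j). {a + i, vertex_at n (b + j)} \<in> H}"
    (is "monge_chain ?p ?q ?M ?E")
  unfolding monge_chain_def
proof (intro conjI allI impI)
  have edge: "k \<noteq> l" if "{k, l} \<in> H" for k l
    using H that pair_in_two_subsets by blast
  {
    fix i j assume ij: "i < ?p" "j < ?q"
    then show "0 \<le> ?M i j" using ab by (intro chord_sine_nonneg) auto
    assume "(i, j) \<in> ?E"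
    \<comment> \<open>The entries that vanish stand for the degenerate pairs \<open>{b, b}\<close> and \<open>{a, a}\<close>.\<close>
    then have "a + i \<noteq> vertex_at n (b + j)" using edge by auto
    then have "a + i \<noteq> b + j" "a + i + n \<noteq> b + j"
      using ij ab by (auto simp: vertex_at_def split: if_splits)
    then show "0 < ?M i j" using ij ab by (intro chord_sine_pos) auto
  next
    fix i' j' i j assume ij: "i' < ?p" "j' < ?q" "i < i'" "j < j'"
    have "chord_sine n (a + i) (a + i') > 0" "chord_sine n (b + j) (b + j') > 0"
      using ij ab by (auto intro!: chord_sine_pos)
    then have "chord_sine n (a + i) (a + i') * chord_sine n (b + j) (b + j') > 0" by simp
    then show "?M i j' * ?M i' j < ?M i j * ?M i' j'"
      using chord_sine_pluecker[of n "a + i" "b + j" "a + i'" "b + j'"] by linarith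
    show "\<not> ((i, j') \<in> ?E \<and> (i', j) \<in> ?E)"
    proof
      assume E: "(i, j') \<in> ?E \<and> (i', j) \<in> ?E"
      define k k' l l' where kl: "k = a + i" "k' = a + i'" "l = b + j" "l' = b + j'"
      define v v' where v: "v = vertex_at n l" "v' = vertex_at n l'"
      have ord: "a \<le> k" "k < k'" "k' \<le> b" "b \<le> l" "l < l'" "l' \<le> a + n"
        using ij ab by (auto simp: kl)
      have mem: "{k, v'} \<in> H" "{k', v} \<in> H" using E by (auto simp: kl v)
      have ne: "k \<noteq> v'" "k' \<noteq> v" using edge mem by blast+
      have "{k, v'} \<inter> {k', v} = {}"
        using ord ne ab by (auto simp: v vertex_at_def split: if_splits)
      then have inter: "interleaved {k, v'} {k', v}" using cross mem by blast
      consider "l' \<le> n" | "l \<le> n" "n < l'" | "n < l" by linarith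
      then have "\<not> interleaved {k, v'} {k', v}"
      proof cases
        case 1
        then have "k' < l" "v = l" "v' = l'" using ord ne by (auto simp: v vertex_at_def)
        then show ?thesis using not_interleaved(2)[of k k' l l'] ord by simp
      next
        case 2
        then have "k' < l" "v = l" "v' < k" using ord ne by (auto simp: v vertex_at_def)
        then show ?thesis using not_interleaved(1)[of v' k k' l] ord
          by (simp add: insert_commute)
      next
        case 3
        then have "v' < k" "v < v'" using ord ne by (auto simp: v vertex_at_def)
        then show ?thesis using not_interleaved(2)[of v v' k k'] ord interleaved_commute
          by (simp add: insert_commute)
      qed
      then show False using inter by simp
    qed
  }
qed

text \<open>The vertex \<open>a\<close> is the first row and the last column of the grid, and \<open>b\<close> is the last row and the
  first column. The hypothesis on the corners makes both requirements on the constant \<open>c\<close> the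
  same.\<close>

lemma glue_scalings:
  fixes x y :: "nat \<Rightarrow> real"
  assumes ab: "1 \<le> a" "a < b" "b \<le> n"
    and xpos: "\<And>i. x i > 0" and ypos: "\<And>j. y j > 0"
    and corners: "x 0 * y 0 = x (b - a) * y (a + n - b)"
  shows "\<exists>r. (\<forall>k. r k > 0) \<and>
    (\<forall>i\<le>b - a. \<forall>j\<le>a + n - b. r (a + i) * r (vertex_at n (b + j)) = x i * y j)"
proof -
  define c where "c = sqrt (y 0 / x (b - a))"
  have c: "c > 0" "c * c = y 0 / x (b - a)"
    using xpos[of "b - a"] ypos[of 0] by (simp_all add: c_def)
  define r where "r k = (if a \<le> k \<and> k \<le> b then c * x (k - a)
    else if b < k then y (k - b) / c else y (k + n - b) / c)" for k
  have rpos: "r k > 0" for k using xpos ypos c by (simp add: r_def)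
  have rA: "r (a + i) = c * x i" if "i \<le> b - a" for i
    using that ab by (auto simp: r_def)
  have rB: "r (vertex_at n (b + j)) = y j / c" if j: "j \<le> a + n - b" for j
  proof -
    consider "j = 0" | "0 < j" "b + j \<le> n" | "n < b + j" "b + j < a + n" | "b + j = a + n"
      using j ab by linarith
    then show ?thesis
    proof cases
      case 1
      have "c * x (b - a) = y 0 / c" using c xpos[of "b - a"] by (simp add: field_simps)
      then show ?thesis using 1 ab by (simp add: vertex_at_def r_def)
    next
      case 2 then show ?thesis using ab by (simp add: vertex_at_def r_def)
    next
      case 3
      then have "\<not> a \<le> b + j - n" "\<not> b < b + j - n" "b + j - n + n - b = j" using ab by auto
      then show ?thesis using 3 by (simp add: vertex_at_def r_def)
    next
      case 4
      then have "j = a + n - b" "b + j - n = a" "\<not> b + j \<le> n" using ab by auto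
      moreover have "c * x 0 = y (a + n - b) / c"
      proof -
        have "x (b - a) * (c * c * x 0) = (c * c * x (b - a)) * x 0" by simp
        also have "c * c * x (b - a) = y 0" using c(2) xpos[of "b - a"] by simp
        also have "y 0 * x 0 = x (b - a) * y (a + n - b)" using corners by (simp add: mult.commute)
        finally have "c * c * x 0 = y (a + n - b)" using xpos[of "b - a"] by simp
        then show ?thesis using c(1) by (simp add: field_simps)
      qed
      ultimately show ?thesis using ab by (simp add: vertex_at_def r_def)
    qed
  qed
  have "r (a + i) * r (vertex_at n (b + j)) = x i * y j" if "i \<le> b - a" "j \<le> a + n - b" for i j
    using rA[OF that(1)] rB[OF that(2)] c(1) by simp
  then show ?thesis using rpos by blast
qed

text \<open>Pairs of vertices in the grid are controlled by the tight scaling. Any other pair is disjoint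
  from \<open>{a, b}\<close> and does not cross it, so by uncrossing its product with the value \<open>1\<close> of \<open>{a, b}\<close> is
  less than a product of two values in the row or column of \<open>a\<close> or \<open>b\<close>.\<close>

lemma tight_radii:
  fixes n :: nat and H :: "nat set set"
  assumes H: "H \<subseteq> two_subsets n" "H \<noteq> {}"
    and cross: "\<And>e f. e \<in> H \<Longrightarrow> f \<in> H \<Longrightarrow> e \<inter> f = {} \<Longrightarrow> interleaved e f"
  shows "\<exists>r. (\<forall>k. r k > 0) \<and> (\<forall>k l. 1 \<le> k \<longrightarrow> k < l \<longrightarrow> l \<le> n \<longrightarrow>
    r k * r l * chord_sine n k l \<le> 1 \<and> (r k * r l * chord_sine n k l = 1 \<longleftrightarrow> {k, l} \<in> H))"
proof -
  obtain e where "e \<in> H" using H by auto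
  with H obtain a b where ab_H: "{a, b} \<in> H" and ab: "1 \<le> a" "a < b" "b \<le> n"
    by (metis subsetD two_subsetsE)
  have n: "n > 0" using ab by simp
  define M where "M i j = chord_sine n (a + i) (b + j)" for i j
  define E where "E = {(i, j). {a + i, vertex_at n (b + j)} \<in> H}"
  obtain x y where t: "tight_scaling (Suc (b - a)) (Suc (a + n - b)) M E x y"
    using monge_chain_tight_scaling[OF chord_grid_monge_chain[OF ab H(1) cross]]
    unfolding M_def[abs_def] E_def by blast
  have xpos: "x i > 0" and ypos: "y j > 0" for i j using t by (simp_all add: tight_scaling_def)
  have "(0, 0) \<in> E" "(b - a, a + n - b) \<in> E"
    using ab_H ab by (auto simp: E_def vertex_at_def insert_commute)
  then have ends: "x 0 * y 0 * M 0 0 = 1" "x (b - a) * y (a + n - b) * M (b - a) (a + n - b) = 1"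
    using t by (auto simp: tight_scaling_def)
  have "M (b - a) (a + n - b) = M 0 0"
    unfolding M_def using chord_sine_around[OF n, of b a] ab by simp
  then have "x 0 * y 0 = x (b - a) * y (a + n - b)"
    using ends by (metis mult_right_cancel mult_zero_right zero_neq_one)
  then obtain r where rpos: "\<And>k. r k > 0"
    and r: "\<And>i j. i \<le> b - a \<Longrightarrow> j \<le> a + n - b \<Longrightarrow>
      r (a + i) * r (vertex_at n (b + j)) = x i * y j"
    using glue_scalings[of a b n x y] ab xpos ypos by blast
  \<comment> \<open>The sine is antisymmetric; ordering the endpoints turns it into a function of the edge.\<close>
  define D where "D k l = r k * r l * chord_sine n (min k l) (max k l)" for k l
  have D_less: "D k l = r k * r l * chord_sine n k l" if "k < l" for k l
    using that by (simp add: D_def)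
  have D_sym: "D k l = D l k" for k l by (simp add: D_def min.commute max.commute mult.commute)
  have grid: "D k l \<le> 1 \<and> (D k l = 1 \<longleftrightarrow> {k, l} \<in> H)"
    if k: "a \<le> k" "k \<le> b" and l: "1 \<le> l \<and> l \<le> a \<or> b \<le> l \<and> l \<le> n" for k l
  proof -
    define i j where "i = k - a" and "j = (if b \<le> l then l - b else l + n - b)"
    have ij: "i \<le> b - a" "j \<le> a + n - b" "k = a + i" "l = vertex_at n (b + j)"
      using k l ab by (auto simp: i_def j_def vertex_at_def)
    have "chord_sine n (min k l) (max k l) = M i j"
    proof (cases "b + j \<le> n")
      case True
      then have "l = b + j" using ij by (simp add: vertex_at_def)
      then show ?thesis using ij k by (simp add: M_def min_def max_def)
    next
      case False
      then have l': "b + j = l + n" "l \<le> a" using ij ab by (auto simp: vertex_at_def)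
      then have "M i j = chord_sine n k (l + n)" using ij(3) by (simp add: M_def)
      moreover have "min k l = l" "max k l = k" using l'(2) k by auto
      ultimately show ?thesis using chord_sine_around[OF n] by simp
    qed
    then have "D k l = x i * y j * M i j"
      unfolding D_def using r[OF ij(1,2)] ij by simp
    then show ?thesis using t ij by (simp add: tight_scaling_def E_def)
  qed
  have D_ab: "D u v \<le> 1" if "u = a \<or> u = b" "1 \<le> v" "v \<le> n" for u v
    using grid[of u v] grid[of v u] D_sym[of u v] that ab by fastforce
  have D_pos: "D k l > 0" if "1 \<le> k" "k < l" "l \<le> n" for k l
    using that rpos[of k] rpos[of l] chord_sine_pos[of k l n] by (simp add: D_less)
  have D_pluecker: "D i k * D j l = D i j * D k l + D i l * D j k"
    if "1 \<le> i" "i < j" "j < k" "k < l" "l \<le> n" for i j k l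
  proof -
    have "D i k * D j l = (r i * r j * r k * r l) * (chord_sine n i k * chord_sine n j l)"
      using that by (simp add: D_less)
    also have "\<dots> = D i j * D k l + D i l * D j k"
      using that by (subst chord_sine_pluecker) (simp add: D_less algebra_simps)
    finally show ?thesis .
  qed
  have all: "D k l \<le> 1 \<and> (D k l = 1 \<longleftrightarrow> {k, l} \<in> H)" if kl: "1 \<le> k" "k < l" "l \<le> n" for k l
  proof (cases "a \<le> k \<and> k \<le> b \<and> (l \<le> a \<or> b \<le> l) \<or> a \<le> l \<and> l \<le> b \<and> (k \<le> a \<or> b \<le> k)")
    case True
    then show ?thesis using grid[of k l] grid[of l k] D_sym[of k l] kl by (auto simp: insert_commute)
  next
    case False
    have disj: "{a, b} \<inter> {k, l} = {}" using False ab kl by auto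
    have not: "\<not> interleaved {a, b} {k, l}"
      using interleavedD[of a b k l] False ab kl by auto
    have "{k, l} \<notin> H" using cross[OF ab_H] disj not by blast
    moreover have "D k l < 1"
    proof -
      have "\<exists>a' b' k' l'. {a, b} = {a', b'} \<and> {k, l} = {k', l'} \<and>
          D a' b' * D k' l' < D a' k' * D b' l'"
      proof (rule pluecker_uncrossing[OF D_sym D_pos D_pluecker _ _ disj not])
        show "{a, b} \<in> two_subsets n" "{k, l} \<in> two_subsets n"
          using ab kl by (auto simp: pair_in_two_subsets)
      qed
      then obtain a' b' k' l' where *: "{a, b} = {a', b'}" "{k, l} = {k', l'}"
        "D a' b' * D k' l' < D a' k' * D b' l'" by blast
      have "a' = a \<or> a' = b" "b' = a \<or> b' = b" "k' = k \<or> k' = l" "l' = k \<or> l' = l"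
        using *(1,2) by (auto simp: doubleton_eq_iff)
      then have ab': "D a' k' \<le> 1" "D b' l' \<le> 1" using D_ab kl by auto
      have "0 < D b' l'"
      proof -
        have "b' \<noteq> l'" "b' \<in> {1..n}" "l' \<in> {1..n}"
          using * disj ab kl by (auto simp: doubleton_eq_iff)
        then show ?thesis using D_pos[of b' l'] D_pos[of l' b'] D_sym[of b' l']
          by (cases "b' < l'") auto
      qed
      then have "D a' k' * D b' l' \<le> 1" using ab' by (simp add: mult_le_one)
      moreover have "D a' b' = D a b" "D k' l' = D k l"
        using * D_sym by (metis doubleton_eq_iff)+
      moreover have "D a b = 1" using grid[of a b] ab ab_H by simp
      ultimately show ?thesis using *(3) by simp
    qed
    ultimately show ?thesis by simp
  qed
  show ?thesis
    using rpos all D_less by (intro exI[of _ r]) simp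
qed

section \<open>The characterisation\<close>

text \<open>The radii are realised by the matrix with columns \<open>r k (cos (\<pi> k / n), sin (\<pi> k / n))\<close>. The
  index of a column starts at \<open>0\<close>, so vertex \<open>k\<close> owns column \<open>k - 1\<close>.\<close>

lemma interleaved_imp_arrangement:
  fixes n :: nat and H :: "nat set set"
  assumes H: "H \<subseteq> two_subsets n" "H \<noteq> {}"
    and cross: "\<And>e f. e \<in> H \<Longrightarrow> f \<in> H \<Longrightarrow> e \<inter> f = {} \<Longrightarrow> interleaved e f"
  shows "arrangement_of_largest_minors n H"
proof -
  obtain r :: "nat \<Rightarrow> real" where r: "\<And>k. r k > 0"
    and tight: "\<And>k l. 1 \<le> k \<Longrightarrow> k < l \<Longrightarrow> l \<le> n \<Longrightarrow>
      r k * r l * chord_sine n k l \<le> 1 \<and> (r k * r l * chord_sine n k l = 1 \<longleftrightarrow> {k, l} \<in> H)"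
    using tight_radii[OF assms] by blast
  define t where "t k = pi * real k / n" for k
  define A where "A = Matrix.mat 2 n (\<lambda>(s, k).
    r (Suc k) * (if s = 0 then cos (t (Suc k)) else sin (t (Suc k))))"
  have A: "A \<in> carrier_mat 2 n" by (simp add: A_def)
  have minor: "minor2 A {k, l} = r k * r l * chord_sine n k l"
    if "1 \<le> k" "k < l" "l \<le> n" for k l
    using that by (simp add: minor2_pair[OF A] chord_sine_def sin_diff flip: t_def)
      (simp add: A_def algebra_simps)
  have pos: "minor2 A I > 0" if I: "I \<in> two_subsets n" for I
  proof -
    obtain k l where kl: "I = {k, l}" "k < l" "1 \<le> k" "l \<le> n"
      using I by (rule two_subsetsE)
    then have "chord_sine n k l > 0" by (intro chord_sine_pos) auto
    then show ?thesis using kl minor r by simp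
  qed
  have val: "minor2 A I \<le> 1 \<and> (minor2 A I = 1 \<longleftrightarrow> I \<in> H)" if I: "I \<in> two_subsets n" for I
  proof -
    obtain k l where "I = {k, l}" "k < l" "1 \<le> k" "l \<le> n"
      using I by (rule two_subsetsE)
    then show ?thesis using minor tight by simp
  qed
  obtain e where "e \<in> H" using H by auto
  with H obtain a b where "{a, b} \<in> H" "a < b" "1 \<le> a" "b \<le> n"
    by (metis subsetD two_subsetsE)
  moreover from this have "minor2 A {a, b} \<noteq> 0" using val H by fastforce
  ultimately have "A \<in> rank2_mats n"
    using A rank_2_if_minor2_nonzero unfolding rank2_mats_def by blast
  then have "row_equiv n `` {A} \<in> Gr_pos n" "A \<in> row_equiv n `` {A}"
    using row_class_in_Gr_pos pos row_equiv_self by auto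
  moreover have "\<forall>I\<in>H. \<forall>K\<in>two_subsets n - H. minor2 A K < minor2 A I"
  proof (intro ballI)
    fix I K assume "I \<in> H" "K \<in> two_subsets n - H"
    then have "minor2 A I = 1" "minor2 A K \<le> 1" "minor2 A K \<noteq> 1"
      using val[of I] val[of K] H(1) by auto
    then show "minor2 A K < minor2 A I" by simp
  qed
  moreover have "\<forall>I\<in>H. \<forall>I'\<in>H. minor2 A I = minor2 A I'" using val H by (metis subsetD)
  ultimately show ?thesis
    unfolding arrangement_of_largest_minors_def using H pos by blast
qed

theorem theorem4p3:
  fixes n :: nat and P :: "nat \<Rightarrow> complex" and H :: "nat set set"
  assumes "n \<ge> 2"
    and "clockwise_placement n P"
    and "H \<subseteq> two_subsets n"
    and "H \<noteq> {}"
  shows "arrangement_of_largest_minors n H \<longleftrightarrow>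
    (\<forall>e\<in>H. \<forall>f\<in>H. e \<noteq> f \<longrightarrow> crossing P e f \<or> e \<inter> f \<noteq> {})"
proof -
  have iff: "crossing P e f \<longleftrightarrow> interleaved e f" if "e \<in> H" "f \<in> H" "e \<inter> f = {}" for e f
    using crossing_iff_interleaved[OF assms(2)] that assms(3) by blast
  show ?thesis
  proof
    assume "arrangement_of_largest_minors n H"
    then show "\<forall>e\<in>H. \<forall>f\<in>H. e \<noteq> f \<longrightarrow> crossing P e f \<or> e \<inter> f \<noteq> {}"
      using arrangement_imp_interleaved iff by blast
  next
    assume *: "\<forall>e\<in>H. \<forall>f\<in>H. e \<noteq> f \<longrightarrow> crossing P e f \<or> e \<inter> f \<noteq> {}"
    have "interleaved e f" if "e \<in> H" "f \<in> H" "e \<inter> f = {}" for e f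
    proof -
      have "e \<noteq> {}" using assms(3) that(1) by (auto simp: two_subsets_def)
      then have "e \<noteq> f" using that(3) by auto
      then show ?thesis using * iff that by blast
    qed
    then show "arrangement_of_largest_minors n H"
      using interleaved_imp_arrangement assms(3,4) by blast
  qed
qed

end
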